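(* Let $B$ be a locale. Let $X$ and $Y$ be pre-Hilbert $B$-modules such that $X$ has a Hilbert basis $\mathit{\Gamma}$ (hence, $X$ is a Hilbert $B$-module), and let $h:X\to Y$ be a homomorphism of $B$-modules. Then $h$ is adjointable with a unique adjoint $h^\dagger:Y\to X$, which is given, for all $y\in Y$, by \[h^\dagger(y)=\bigvee_{t\in\mathit{\Gamma}}\langle h(t),y\rangle t\;.\]
   Context: A $B$-module is a complete lattice $X$ with an action $B\times X\to X$, $(b,x)\mapsto bx$, preserving arbitrary joins in each variable and satisfying $1x=x$ and $(b\wedge c)x=b(cx)$. A homomorphism of $B$-modules preserves arbitrary joins and the action. A pre-Hilbert $B$-module is a $B$-module $X$ with a function $\langle-,-\rangle:X\times X\to B$ (inner product) such that $\langle bx,y\rangle=b\wedge\langle x,y\rangle$, $\langle\bigvee_\alpha x_\alpha,y\rangle=\bigvee_\alpha\langle x_\alpha,y\rangle$ and $\langle x,y\rangle=\langle y,x\rangle$. It is a Hilbert $B$-module if moreover $\langle x,-\rangle=\langle y,-\rangle$ implies $x=y$ (non-degeneracy). A Hilbert basis of a pre-Hilbert $B$-module $X$ is a subset $\mathit{\Gamma}\subset X$ such that $x=\bigvee_{s\in\mathit{\Gamma}}\langle x,s\rangle s$ for all $x\in X$. A function $h:X\to Y$ between pre-Hilbert $B$-modules is adjointable if there is a function $h^\dagger:Y\to X$ (an adjoint of $h$) such that $\langle h(x),y\rangle=\langle x,h^\dagger(y)\rangle$ for all $x\in X$, $y\in Y$. *)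

theory Defs
  imports Main
begin

(* A locale in the sense of pointfree topology.  The library class
   complete_distrib_lattice asks for complete distributivity, which is strictly stronger. *)
class frame = complete_lattice +
  assumes frame_distrib: "inf b (Sup S) = (SUP c\<in>S. inf b c)"

(* The unit 1 of B is its top element.  Set-indexed joins include the empty one, so that
   the action preserves bottom in each variable. *)
locale frame_module =
  fixes act :: "'b::frame \<Rightarrow> 'x::complete_lattice \<Rightarrow> 'x"
  assumes act_Sup_left: "act (Sup S) x = (SUP b\<in>S. act b x)"
    and act_Sup_right: "act b (Sup A) = (SUP x\<in>A. act b x)"
    and act_top: "act top x = x"
    and act_inf: "act (inf b c) x = act b (act c x)"

locale frame_module_hom =
  dom: frame_module actX + cod: frame_module actY
  for actX :: "'b::frame \<Rightarrow> 'x::complete_lattice \<Rightarrow> 'x"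
    and actY :: "'b \<Rightarrow> 'y::complete_lattice \<Rightarrow> 'y" +
  fixes h :: "'x \<Rightarrow> 'y"
  assumes hom_Sup: "h (Sup A) = (SUP x\<in>A. h x)"
    and hom_act: "h (actX b x) = actY b (h x)"

locale pre_hilbert_module = frame_module act
  for act :: "'b::frame \<Rightarrow> 'x::complete_lattice \<Rightarrow> 'x" +
  fixes ip :: "'x \<Rightarrow> 'x \<Rightarrow> 'b"
  assumes ip_act: "ip (act b x) y = inf b (ip x y)"
    and ip_Sup: "ip (Sup A) y = (SUP x\<in>A. ip x y)"
    and ip_sym: "ip x y = ip y x"

locale hilbert_module = pre_hilbert_module +
  assumes nondegenerate: "ip x = ip y \<Longrightarrow> x = y"

definition hilbert_basis ::
  "('b::frame \<Rightarrow> 'x::complete_lattice \<Rightarrow> 'x) \<Rightarrow> ('x \<Rightarrow> 'x \<Rightarrow> 'b) \<Rightarrow> 'x set \<Rightarrow> bool"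
  where "hilbert_basis act ip \<Gamma> \<longleftrightarrow> (\<forall>x. x = (SUP s\<in>\<Gamma>. act (ip x s) s))"

definition is_adjoint ::
  "('x \<Rightarrow> 'x \<Rightarrow> 'b) \<Rightarrow> ('y \<Rightarrow> 'y \<Rightarrow> 'b) \<Rightarrow> ('x \<Rightarrow> 'y) \<Rightarrow> ('y \<Rightarrow> 'x) \<Rightarrow> bool"
  where "is_adjoint ipX ipY h k \<longleftrightarrow> (\<forall>x y. ipY (h x) y = ipX x (k y))"

definition adjointable ::
  "('x \<Rightarrow> 'x \<Rightarrow> 'b) \<Rightarrow> ('y \<Rightarrow> 'y \<Rightarrow> 'b) \<Rightarrow> ('x \<Rightarrow> 'y) \<Rightarrow> bool"
  where "adjointable ipX ipY h \<longleftrightarrow> (\<exists>k. is_adjoint ipX ipY h k)"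

end

theory Submission
  imports Defs
begin

text \<open>Expanding \<open>x\<close> in the basis and using that \<open>h\<close> preserves joins
  and the action gives \<open>ipY (h x) y\<close> as the join over \<open>t\<close> in the basis of
  \<open>inf (ipX x t) (ipY (h t) y)\<close>. By symmetry this is also the inner product of
  \<open>x\<close> with the join of the \<open>actX (ipY (h t) y) t\<close>, so that join defines an
  adjoint (\<open>is_adjoint_hilbert_basis\<close>). Conversely, the values of an adjoint have their
  basis coefficients prescribed by \<open>h\<close>, and an element is the join of its coefficients
  times basis elements; this gives the formula and uniqueness
  (\<open>is_adjoint_eq_hilbert_basis\<close>).\<close>

lemma hilbert_basis_expand:
  assumes "hilbert_basis act ip \<Gamma>"
  shows "(SUP s\<in>\<Gamma>. act (ip x s) s) = x"
  by (rule assms[unfolded hilbert_basis_def, THEN spec[where x = x], symmetric])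

text \<open>The basis expansion of \<open>x\<close> involves \<open>x\<close> only through the
  function \<open>ip x\<close>, so this function determines \<open>x\<close>.\<close>

lemma hilbert_basis_imp_hilbert_module:
  assumes "pre_hilbert_module act ip" and basis: "hilbert_basis act ip \<Gamma>"
  shows "hilbert_module act ip"
proof -
  interpret pre_hilbert_module act ip by fact
  show ?thesis
  proof
    fix x y
    assume eq: "ip x = ip y"
    show "x = y"
      by (rule hilbert_basis_expand[OF basis, of x, unfolded eq, THEN sym, THEN trans])
        (rule hilbert_basis_expand[OF basis])
  qed
qed

lemma (in pre_hilbert_module) ip_SUP_act:
  "ip (SUP t\<in>A. act (b t) (f t)) y = (SUP t\<in>A. inf (b t) (ip (f t) y))"
  by (simp add: ip_Sup ip_act image_image)

lemma (in frame_module_hom) hom_SUP_act: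
  "h (SUP t\<in>A. actX (b t) (f t)) = (SUP t\<in>A. actY (b t) (h (f t)))"
  by (simp add: hom_Sup hom_act image_image)

lemma is_adjoint_hilbert_basis:
  assumes "pre_hilbert_module actX ipX" and "pre_hilbert_module actY ipY"
    and basis: "hilbert_basis actX ipX \<Gamma>" and "frame_module_hom actX actY h"
  shows "is_adjoint ipX ipY h (\<lambda>y. SUP t\<in>\<Gamma>. actX (ipY (h t) y) t)"
  unfolding is_adjoint_def
proof (intro allI)
  fix x y
  interpret X: pre_hilbert_module actX ipX by fact
  interpret Y: pre_hilbert_module actY ipY by fact
  interpret frame_module_hom actX actY h by fact
  have "ipY (h x) y = ipY (h (SUP t\<in>\<Gamma>. actX (ipX x t) t)) y"
    by (simp only: hilbert_basis_expand[OF basis])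
  also have "\<dots> = (SUP t\<in>\<Gamma>. inf (ipX x t) (ipY (h t) y))"
    by (simp only: hom_SUP_act Y.ip_SUP_act)
  \<comment> \<open>Joins and scalars come out of the first argument of \<open>ipX\<close>, so
    \<open>t\<close> is moved there, and \<open>ipY (h t) y\<close> takes over the role of the
    scalar.\<close>
  also have "\<dots> = (SUP t\<in>\<Gamma>. inf (ipY (h t) y) (ipX t x))"
    by (subst X.ip_sym, subst inf_commute) (rule refl)
  also have "\<dots> = ipX (SUP t\<in>\<Gamma>. actX (ipY (h t) y) t) x"
    by (simp only: X.ip_SUP_act)
  also have "\<dots> = ipX x (SUP t\<in>\<Gamma>. actX (ipY (h t) y) t)"
    by (rule X.ip_sym)
  finally show "ipY (h x) y = ipX x (SUP t\<in>\<Gamma>. actX (ipY (h t) y) t)" .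
qed

text \<open>Adjointness tested at a basis element \<open>t\<close> gives the coefficient of
  \<open>k y\<close> at \<open>t\<close>, namely \<open>ipY (h t) y\<close>; the basis expansion
  then recovers \<open>k y\<close>.\<close>

lemma is_adjoint_eq_hilbert_basis:
  assumes "pre_hilbert_module actX ipX" and basis: "hilbert_basis actX ipX \<Gamma>"
    and adj: "is_adjoint ipX ipY h k"
  shows "k y = (SUP t\<in>\<Gamma>. actX (ipY (h t) y) t)"
proof -
  interpret pre_hilbert_module actX ipX by fact
  have "ipX (k y) t = ipY (h t) y" for t
    unfolding ip_sym[of "k y" t] by (rule adj[unfolded is_adjoint_def, rule_format, symmetric])
  from hilbert_basis_expand[OF basis, of "k y", unfolded this] show ?thesis
    by (rule sym)
qed

theorem theorem4p2:
  fixes actX :: "'b::frame \<Rightarrow> 'x::complete_lattice \<Rightarrow> 'x"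
    and ipX :: "'x \<Rightarrow> 'x \<Rightarrow> 'b"
    and actY :: "'b \<Rightarrow> 'y::complete_lattice \<Rightarrow> 'y"
    and ipY :: "'y \<Rightarrow> 'y \<Rightarrow> 'b"
    and \<Gamma> :: "'x set"
    and h :: "'x \<Rightarrow> 'y"
  assumes "pre_hilbert_module actX ipX"
    and "pre_hilbert_module actY ipY"
    and "hilbert_basis actX ipX \<Gamma>"
    and "frame_module_hom actX actY h"
  shows "hilbert_module actX ipX \<and>
    adjointable ipX ipY h \<and>
    (\<exists>!k. is_adjoint ipX ipY h k) \<and>
    (\<forall>k. is_adjoint ipX ipY h k \<longrightarrow> (\<forall>y. k y = (SUP t\<in>\<Gamma>. actX (ipY (h t) y) t)))"
proof (intro conjI allI impI)
  let ?k = "\<lambda>y. SUP t\<in>\<Gamma>. actX (ipY (h t) y) t"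
  have adj: "is_adjoint ipX ipY h ?k"
    using assms by (rule is_adjoint_hilbert_basis)
  \<comment> \<open>Besides being the last conjunct, this pointwise formula yields uniqueness below
    by extensionality.\<close>
  show formula: "k y = ?k y" if "is_adjoint ipX ipY h k" for k y
    using assms(1,3) that by (rule is_adjoint_eq_hilbert_basis)
  show "hilbert_module actX ipX"
    using assms(1,3) by (rule hilbert_basis_imp_hilbert_module)
  show "adjointable ipX ipY h"
    unfolding adjointable_def using adj by (rule exI[where x = ?k])
  show "\<exists>!k. is_adjoint ipX ipY h k"
  proof (rule ex1I[where a = ?k])
    show "is_adjoint ipX ipY h ?k" by (rule adj)
    show "k = ?k" if "is_adjoint ipX ipY h k" for k
      using formula[OF that] by (rule ext)
  qed
qed

end
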